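(* Let $k \in \mathbb{N}$, $c \geq 0$ and $\omega > 0$, with $4 \omega > c^2$. For any number $0 < \varepsilon < 1/\omega$, consider the function $$\Upsilon_\varepsilon(x, t) := \varepsilon^{-\frac12} \check{V}_{c_\varepsilon, \omega_\varepsilon}(x - c t) \, e^{i \omega t}, \qquad (x,t) \in \mathbb{R}^2,$$ where $\check V_{c_\varepsilon,\omega_\varepsilon}$ is the explicit profile given in the context, and let $\Psi_{c,\omega}$ be the bright soliton of the cubic Schrödinger equation given in the context. There exists a positive number $C_k$, depending only on $k$, $c$ and $\omega$, such that $$\| \Upsilon_\varepsilon(\cdot, t) - \Psi_{c,\omega}(\cdot, t) \|_{H^k(\mathbb{R})} \underset{\varepsilon \to 0}{\sim} C_k \, \varepsilon,$$ for any $t \in \mathbb{R}$.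
   Context: The bright soliton with speed $c$ and angular velocity $\omega$ of the cubic Schrödinger equation $i \partial_t \Psi + \partial_{xx} \Psi + \frac12 |\Psi|^2 \Psi = 0$ is $$\Psi_{c,\omega}(x,t) = \frac{(4\omega - c^2)^{\frac12} \, e^{i \frac{c (x - ct)}{2}}}{\cosh \big( \frac{(4\omega - c^2)^{\frac12}}{2} (x - ct) \big)} \, e^{i \omega t}.$$ The profile $\check V_{c_\varepsilon, \omega_\varepsilon} = [V_{c_\varepsilon,\omega_\varepsilon}]_1 + i [V_{c_\varepsilon,\omega_\varepsilon}]_3$ is the one of the soliton $\check m(x,t) = \check V_{c_\varepsilon,\omega_\varepsilon}(x - c_\varepsilon t)e^{i\omega_\varepsilon t}$ (with $\check m = m_1 + i m_3$) of the one-dimensional Landau-Lifshitz equation $\partial_t m + m \times (\partial_{xx} m - \lambda_\varepsilon(m_1 e_1 + m_3 e_3)) = 0$ for the parameters $c_\varepsilon = c$, $\lambda_\varepsilon = 1/\varepsilon$, $\omega_\varepsilon = \omega - 1/\varepsilon$, and with $m_2 \to 1$ at infinity ($\delta_\varepsilon = 1$). Thus $\Upsilon_\varepsilon(x,t) = \varepsilon^{-1/2} \check m(x,t) e^{it/\varepsilon}$. Explicitly, for $x \in \mathbb{R}$, $$\begin{aligned} \check{V}_{c_\varepsilon, \omega_\varepsilon}(x) = {} & \frac{\varepsilon^{\frac12} (4\omega - c^2)^{\frac12} e^{\frac{i c x}{2}}}{1 + \omega \varepsilon + (1 + (c^2 - 2\omega) \varepsilon + \omega^2 \varepsilon^2)^{\frac12}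 \cosh \big( (4\omega - c^2)^{\frac12} x \big)} \\ & \times \bigg( \big( 2 (1 + (c^2 - 2\omega)\varepsilon + \omega^2 \varepsilon^2)^{\frac12} + 2 + (c^2 - 2\omega) \varepsilon \big)^{\frac12} \cosh \Big( \Big( \omega - \frac{c^2}{4} \Big)^{\frac12} x \Big) \\ & \quad + i \, \mathrm{sign}(c) \big( 2 (1 + (c^2 - 2\omega)\varepsilon + \omega^2 \varepsilon^2)^{\frac12} - 2 + (2\omega - c^2) \varepsilon \big)^{\frac12} \sinh \Big( \Big( \omega - \frac{c^2}{4} \Big)^{\frac12} x \Big) \bigg). \end{aligned}$$ (When $c = 0$ the coefficient of $\sinh$ vanishes, so the value of $\mathrm{sign}(0)$ is irrelevant.) The notation $f(\varepsilon) \sim C_k \varepsilon$ as $\varepsilon \to 0$ means $f(\varepsilon)/(C_k\varepsilon) \to 1$ as $\varepsilon \to 0^+$. *)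

theory Defs
  imports "HOL-Analysis.Analysis" "HOL-Library.Landau_Symbols"
begin

definition test_function :: "(real \<Rightarrow> real) \<Rightarrow> bool" where
  "test_function \<phi> \<longleftrightarrow>
     (\<forall>n x. (deriv ^^ n) \<phi> field_differentiable (at x)) \<and>
     compact (closure {x. \<phi> x \<noteq> 0})"

definition locally_integrable :: "(real \<Rightarrow> complex) \<Rightarrow> bool" where
  "locally_integrable f \<longleftrightarrow> (\<forall>K. compact K \<longrightarrow> set_integrable lborel K f)"

definition has_weak_deriv :: "nat \<Rightarrow> (real \<Rightarrow> complex) \<Rightarrow> (real \<Rightarrow> complex) \<Rightarrow> bool" where
  "has_weak_deriv j f g \<longleftrightarrow>
     locally_integrable f \<and> locally_integrable g \<and>
     (\<forall>\<phi>. test_function \<phi> \<longrightarrow>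
        (LINT x|lborel. (deriv ^^ j) \<phi> x *\<^sub>R f x) = (- 1) ^ j * (LINT x|lborel. \<phi> x *\<^sub>R g x))"

text \<open>A weak derivative is unique up to a null set, so the choice of representative below
  affects no integral.\<close>

definition weak_deriv :: "nat \<Rightarrow> (real \<Rightarrow> complex) \<Rightarrow> real \<Rightarrow> complex" where
  "weak_deriv j f = (SOME g. has_weak_deriv j f g)"

definition square_integrable :: "(real \<Rightarrow> complex) \<Rightarrow> bool" where
  "square_integrable f \<longleftrightarrow>
     f \<in> borel_measurable lborel \<and> integrable lborel (\<lambda>x. (norm (f x))\<^sup>2)"

text \<open>The space $H^k(\mathbb{R})$ of complex-valued functions. The case $j = 0$ says that
  \<open>f\<close> itself is in $L^2$.\<close>

definition sobolev_space :: "nat \<Rightarrow> (real \<Rightarrow> complex) set" where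
  "sobolev_space k =
     {f. \<forall>j\<le>k. \<exists>g. has_weak_deriv j f g \<and> square_integrable g}"

text \<open>Meaningful only on \<open>sobolev_space k\<close>: elsewhere the chosen representatives or the
  integrals are arbitrary default values.\<close>

definition sobolev_norm :: "nat \<Rightarrow> (real \<Rightarrow> complex) \<Rightarrow> real" where
  "sobolev_norm k f = sqrt (\<Sum>j\<le>k. LINT x|lborel. (norm (weak_deriv j f x))\<^sup>2)"

definition bright_soliton :: "real \<Rightarrow> real \<Rightarrow> real \<Rightarrow> real \<Rightarrow> complex" where
  "bright_soliton c \<omega> x t =
     complex_of_real (sqrt (4 * \<omega> - c\<^sup>2)) * exp (\<i> * complex_of_real (c * (x - c * t) / 2))
       / complex_of_real (cosh (sqrt (4 * \<omega> - c\<^sup>2) / 2 * (x - c * t)))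
       * exp (\<i> * complex_of_real (\<omega> * t))"

text \<open>The profile $\check V = V_1 + i V_3$ of the Landau-Lifshitz soliton with speed $c$,
  angular velocity $\omega - 1/\varepsilon$, anisotropy $\lambda = 1/\varepsilon$, and
  $m_2 \to 1$ at infinity.\<close>

definition LL_profile :: "real \<Rightarrow> real \<Rightarrow> real \<Rightarrow> real \<Rightarrow> complex" where
  "LL_profile c \<omega> \<epsilon> x =
     (let r = sqrt (1 + (c\<^sup>2 - 2 * \<omega>) * \<epsilon> + \<omega>\<^sup>2 * \<epsilon>\<^sup>2) in
       complex_of_real (sqrt \<epsilon> * sqrt (4 * \<omega> - c\<^sup>2)) * exp (\<i> * complex_of_real (c * x / 2))
         / complex_of_real (1 + \<omega> * \<epsilon> + r * cosh (sqrt (4 * \<omega> - c\<^sup>2) * x))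
         * (complex_of_real (sqrt (2 * r + 2 + (c\<^sup>2 - 2 * \<omega>) * \<epsilon>)
                              * cosh (sqrt (\<omega> - c\<^sup>2 / 4) * x))
            + \<i> * complex_of_real (sgn c * sqrt (2 * r - 2 + (2 * \<omega> - c\<^sup>2) * \<epsilon>)
                                    * sinh (sqrt (\<omega> - c\<^sup>2 / 4) * x))))"

definition rescaled_LL_soliton :: "real \<Rightarrow> real \<Rightarrow> real \<Rightarrow> real \<Rightarrow> real \<Rightarrow> complex" where
  "rescaled_LL_soliton c \<omega> \<epsilon> x t =
     complex_of_real (1 / sqrt \<epsilon>) * LL_profile c \<omega> \<epsilon> (x - c * t)
       * exp (\<i> * complex_of_real (\<omega> * t))"

end

theory Submission
  imports Defs "HOL-Computational_Algebra.Polynomial"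
begin

text \<open>Put \<open>y = x - c t\<close>, \<open>S = sech (a y / 2)\<close> and \<open>T = tanh (a y / 2)\<close> with \<open>a\<^sup>2 = 4 \<omega> - c\<^sup>2\<close>. Dividing
  the numerator and the denominator of the Landau-Lifshitz profile by \<open>cosh\<^sup>2 (a y / 2)\<close> turns
  its denominator into \<open>1 / E = 2 r + (1 + \<omega> \<epsilon> - r) S\<^sup>2\<close>, which is bounded away from 0, and the
  difference of the two solitons into a constant phase times \<open>\<epsilon> S h\<close>, where \<open>h\<close> is the carrier
  \<open>exp (i c y / 2)\<close> times a polynomial in \<open>S\<close>, \<open>T\<close>, \<open>E\<close> whose coefficients are continuous in
  \<open>\<epsilon>\<close> up to \<open>\<epsilon> = 0\<close>. Functions of the form \<open>S h\<close> are stable under differentiation in \<open>y\<close> and,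
  locally uniformly in \<open>\<epsilon>\<close>, dominated by multiples of \<open>S\<close>, which lies in \<open>L\<^sup>2\<close>. Hence every derivative of the
  difference divided by \<open>\<epsilon>\<close> converges in \<open>L\<^sup>2\<close> norm by dominated convergence, and the limit is not zero because
  \<open>h\<close> does not vanish at \<open>\<epsilon> = y = 0\<close>. Translations and constant phases do not change the norms,
  so the limit does not depend on \<open>t\<close>.\<close>

section \<open>Weak derivatives\<close>

text \<open>All derivatives of the flat function \<open>exp (- \<sigma> / x)\<close>, extended by 0
  to the left, have this form, with a polynomial in \<open>1 / x\<close>. The parameter
  \<open>\<sigma>\<close> later tends to 0, which turns bumps into indicators of intervals.\<close>

definition flat_exp :: "real \<Rightarrow> real poly \<Rightarrow> real \<Rightarrow> real" where
  "flat_exp \<sigma> p x = (if x \<le> 0 then 0 else poly p (1 / x) * exp (- \<sigma> / x))"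

lemma tendsto_poly_times_exp_neg:
  fixes p :: "real poly"
  assumes "\<sigma> > 0"
  shows "((\<lambda>u. poly p u * exp (- \<sigma> * u)) \<longlongrightarrow> 0) at_top"
proof -
  have "((\<lambda>u::real. u ^ n * exp (- \<sigma> * u)) \<longlongrightarrow> 0) at_top" for n
  proof -
    have "filterlim (\<lambda>u. \<sigma> * u) at_top at_top"
      using assms by (intro filterlim_tendsto_pos_mult_at_top[OF tendsto_const]) (auto simp: filterlim_ident)
    from tendsto_mult_right_zero[OF filterlim_compose[OF tendsto_power_div_exp_0[of n] this], of "1 / \<sigma> ^ n"]
    show ?thesis using assms by (simp add: power_mult_distrib exp_minus field_simps)
  qed
  then have "((\<lambda>u. \<Sum>i\<le>degree p. coeff p i * (u ^ i * exp (- \<sigma> * u))) \<longlongrightarrow> (\<Sum>i\<le>degree p. 0)) at_top"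
    by (intro tendsto_sum tendsto_mult_right_zero)
  then show ?thesis
    by (simp add: poly_altdef sum_distrib_right mult.assoc)
qed

text \<open>With \<open>u = 1 / x\<close>, differentiation in \<open>x\<close> is
  \<open>- u\<^sup>2\<close> times differentiation in \<open>u\<close>, whence the factor
  \<open>[:0, 0, 1:]\<close>. At 0 the difference quotient from the right is
  \<open>u * poly p u * exp (- \<sigma> * u)\<close> with \<open>u\<close> tending to infinity, and
  the exponential wins.\<close>

lemma flat_exp_has_derivative:
  assumes "\<sigma> > 0"
  shows "(flat_exp \<sigma> p has_real_derivative flat_exp \<sigma> ([:0, 0, 1:] * (smult \<sigma> p - pderiv p)) x) (at x)"
proof (cases x "0 :: real" rule: linorder_cases)
  case less
  then have "eventually (\<lambda>y. flat_exp \<sigma> p y = 0) (nhds x)"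
    using eventually_nhds_in_open[of "{..<0}" x] by (auto simp: flat_exp_def elim: eventually_mono)
  then have "(flat_exp \<sigma> p has_real_derivative 0) (at x)"
    by (subst DERIV_cong_ev[OF refl _ refl]) auto
  with less show ?thesis
    by (simp add: flat_exp_def[of _ _ x])
next
  case greater
  then have ev: "eventually (\<lambda>y. flat_exp \<sigma> p y = poly p (1 / y) * exp (- \<sigma> / y)) (nhds x)"
    using eventually_nhds_in_open[of "{0<..}" x] by (auto simp: flat_exp_def elim: eventually_mono)
  have "((\<lambda>y. poly p (1 / y) * exp (- \<sigma> / y)) has_real_derivative
      flat_exp \<sigma> ([:0, 0, 1:] * (smult \<sigma> p - pderiv p)) x) (at x)"
    using greater by (auto intro!: derivative_eq_intros DERIV_chain2[OF poly_DERIV]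
        simp: flat_exp_def algebra_simps power2_eq_square divide_inverse)
  with DERIV_cong_ev[OF refl ev refl] show ?thesis by simp
next
  case equal
  have "((\<lambda>h. (flat_exp \<sigma> p (0 + h) - flat_exp \<sigma> p 0) / h) \<longlongrightarrow> 0) (at_right 0)"
  proof -
    have "((\<lambda>h. poly (pCons 0 p) (inverse h) * exp (- \<sigma> * inverse h)) \<longlongrightarrow> 0) (at_right 0)"
      by (rule filterlim_compose[OF tendsto_poly_times_exp_neg[OF assms] filterlim_inverse_at_top_right])
    then show ?thesis
      by (rule Lim_transform_eventually)
        (auto simp: eventually_at_right_less flat_exp_def field_simps intro!: eventually_at_rightI[of 0 1])
  qed
  moreover have "((\<lambda>h. (flat_exp \<sigma> p (0 + h) - flat_exp \<sigma> p 0) / h) \<longlongrightarrow> 0) (at_left 0)"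
    by (rule tendsto_eventually) (auto simp: flat_exp_def intro!: eventually_at_leftI[of "-1"])
  ultimately have "((\<lambda>h. (flat_exp \<sigma> p (0 + h) - flat_exp \<sigma> p 0) / h) \<longlongrightarrow> 0) (at 0)"
    by (simp add: filterlim_split_at)
  with equal show ?thesis
    by (simp add: DERIV_def flat_exp_def)
qed

text \<open>Smoothness of a bump follows from the closure of this set under differentiation, without
  computing iterated derivatives.\<close>

inductive_set bump_algebra :: "real \<Rightarrow> real \<Rightarrow> real \<Rightarrow> (real \<Rightarrow> real) set"
  for \<sigma> a b where
    left: "(\<lambda>x. flat_exp \<sigma> p (x - a)) \<in> bump_algebra \<sigma> a b"
  | right: "(\<lambda>x. flat_exp \<sigma> p (b - x)) \<in> bump_algebra \<sigma> a b"
  | add: "f \<in> bump_algebra \<sigma> a b \<Longrightarrow> g \<in> bump_algebra \<sigma> a b \<Longrightarrow> (\<lambda>x. f x + g x) \<in> bump_algebra \<sigma> a b"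
  | mult: "f \<in> bump_algebra \<sigma> a b \<Longrightarrow> g \<in> bump_algebra \<sigma> a b \<Longrightarrow> (\<lambda>x. f x * g x) \<in> bump_algebra \<sigma> a b"

lemma bump_algebra_derivative:
  assumes "\<sigma> > 0" "f \<in> bump_algebra \<sigma> a b"
  shows "\<exists>f' \<in> bump_algebra \<sigma> a b. \<forall>x. (f has_real_derivative f' x) (at x)"
  using assms(2)
proof induction
  case (left p)
  have "((\<lambda>x. flat_exp \<sigma> p (x - a)) has_real_derivative
      flat_exp \<sigma> ([:0, 0, 1:] * (smult \<sigma> p - pderiv p)) (x - a)) (at x)" for x
    by (rule DERIV_cong[OF DERIV_chain2[OF flat_exp_has_derivative[OF assms(1)]]])
      (auto intro!: derivative_eq_intros)
  then show ?case
    by (intro bexI[OF _ bump_algebra.left[of \<sigma> "[:0, 0, 1:] * (smult \<sigma> p - pderiv p)"]]) blast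
next
  case (right p)
  \<comment> \<open>The reflection contributes a sign, absorbed by replacing \<open>p\<close> with
    \<open>- p\<close>.\<close>
  have "((\<lambda>x. flat_exp \<sigma> p (b - x)) has_real_derivative
      flat_exp \<sigma> ([:0, 0, 1:] * (smult \<sigma> (- p) - pderiv (- p))) (b - x)) (at x)" for x
    by (rule DERIV_cong[OF DERIV_chain2[OF flat_exp_has_derivative[OF assms(1)]]])
      (auto intro!: derivative_eq_intros simp: flat_exp_def pderiv_minus algebra_simps)
  then show ?case
    by (intro bexI[OF _ bump_algebra.right[of \<sigma> "[:0, 0, 1:] * (smult \<sigma> (- p) - pderiv (- p))"]]) blast
next
  case (add f g)
  then obtain f' g' where *: "f' \<in> bump_algebra \<sigma> a b" "g' \<in> bump_algebra \<sigma> a b"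
    "\<forall>x. (f has_real_derivative f' x) (at x)" "\<forall>x. (g has_real_derivative g' x) (at x)" by blast
  then show ?case
    by (intro bexI[of _ "\<lambda>x. f' x + g' x"]) (auto intro!: bump_algebra.add DERIV_add)
next
  case (mult f g)
  then obtain f' g' where *: "f' \<in> bump_algebra \<sigma> a b" "g' \<in> bump_algebra \<sigma> a b"
    "\<forall>x. (f has_real_derivative f' x) (at x)" "\<forall>x. (g has_real_derivative g' x) (at x)" by blast
  then have "((\<lambda>x. f x * g x) has_real_derivative f' x * g x + g' x * f x) (at x)" for x
    by (intro DERIV_mult) auto
  with * mult.hyps show ?case
    by (intro bexI[of _ "\<lambda>x. f' x * g x + g' x * f x"]) (auto intro!: bump_algebra.add bump_algebra.mult)
qed

lemma iterated_deriv_bump_algebra: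
  assumes "\<sigma> > 0" "f \<in> bump_algebra \<sigma> a b"
  shows "(deriv ^^ n) f \<in> bump_algebra \<sigma> a b"
proof (induction n)
  case (Suc n)
  then obtain f' where f': "f' \<in> bump_algebra \<sigma> a b"
      "\<forall>x. ((deriv ^^ n) f has_real_derivative f' x) (at x)"
    using bump_algebra_derivative[OF assms(1)] by blast
  then have "deriv ((deriv ^^ n) f) = f'" by (auto intro!: DERIV_imp_deriv)
  with f' show ?case by simp
qed (use assms in simp)

lemma test_function_bump:
  assumes "\<sigma> > 0"
  shows "test_function (\<lambda>x. flat_exp \<sigma> 1 (x - a) * flat_exp \<sigma> 1 (b - x))" (is "test_function ?\<phi>")
  unfolding test_function_def
proof (intro conjI allI)
  fix n x
  have "?\<phi> \<in> bump_algebra \<sigma> a b" by (intro bump_algebra.intros)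
  from bump_algebra_derivative[OF assms iterated_deriv_bump_algebra[OF assms this, of n]]
  show "(deriv ^^ n) ?\<phi> field_differentiable at x"
    unfolding field_differentiable_def by blast
next
  have "{x. ?\<phi> x \<noteq> 0} \<subseteq> {a..b}" by (auto simp: flat_exp_def split: if_splits)
  then have "bounded {x. ?\<phi> x \<noteq> 0}" by (rule bounded_subset[OF bounded_closed_interval])
  then show "compact (closure {x. ?\<phi> x \<noteq> 0})" by simp
qed

section \<open>Fundamental lemma of the calculus of variations\<close>

text \<open>Integrability is given only for truncations to compact sets, so \<open>h\<close> is
  written as a pointwise limit of such truncations.\<close>

lemma locally_integrable_borel_measurable:
  assumes "locally_integrable h"
  shows "h \<in> borel_measurable borel"
proof (rule borel_measurable_LIMSEQ_metric[where f = "\<lambda>n x. indicat_real {- real n..real n} x *\<^sub>R h x"])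
  show "(\<lambda>x. indicat_real {- real n..real n} x *\<^sub>R h x) \<in> borel_measurable borel" for n
    using assms unfolding locally_integrable_def set_integrable_def
    by (auto dest!: spec[of _ "{- real n..real n}"] dest: borel_measurable_integrable)
  fix x
  obtain N where N: "\<bar>x\<bar> \<le> real N" using real_arch_simple by blast
  show "(\<lambda>n. indicat_real {- real n..real n} x *\<^sub>R h x) \<longlonglongrightarrow> h x"
    by (rule tendsto_eventually, rule eventually_sequentiallyI[of N]) (use N in \<open>auto simp: indicator_def\<close>)
qed

lemma continuous_imp_locally_integrable:
  assumes "continuous_on UNIV f"
  shows "locally_integrable f"
  unfolding locally_integrable_def set_integrable_def
  by (intro allI impI borel_integrable_compact continuous_on_subset[OF assms subset_UNIV])

text \<open>Bumps with \<open>\<sigma>\<close> tending to 0 converge boundedly to indicators of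
  intervals, so \<open>h\<close> has zero integral over every interval. Intervals generate the Borel
  sets, and vanishing integrals over all Borel sets force a function to be zero almost
  everywhere.\<close>

lemma weakly_zero_imp_AE_zero:
  assumes h: "locally_integrable h"
    and zero: "\<And>\<phi>. test_function \<phi> \<Longrightarrow> (LINT x|lborel. \<phi> x *\<^sub>R h x) = 0"
  shows "AE x in lborel. h x = 0"
proof -
  note [measurable] = locally_integrable_borel_measurable[OF h]
  have int: "integrable lborel (\<lambda>x. indicat_real {a..b} x *\<^sub>R h x)" for a b
    using h unfolding locally_integrable_def set_integrable_def by simp
  have Icc: "(LINT x|lborel. indicat_real {a..b} x *\<^sub>R h x) = 0" for a b
  proof -
    \<comment> \<open>\<open>Suc n\<close> keeps \<open>\<sigma>\<close> positive at
      \<open>n = 0\<close> too, where \<open>1 / real n\<close> would be 0.\<close>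
    define \<phi> where "\<phi> n x = flat_exp (1 / real (Suc n)) 1 (x - a) * flat_exp (1 / real (Suc n)) 1 (b - x)" for n x
    have test: "test_function (\<phi> n)" for n
      unfolding \<phi>_def by (rule test_function_bump) simp
    have [measurable]: "\<phi> n \<in> borel_measurable borel" for n
      using test[of n, unfolded test_function_def, THEN conjunct1, rule_format, of 0]
      by (auto intro!: borel_measurable_continuous_onI continuous_at_imp_continuous_on
          field_differentiable_imp_continuous_at)
    have lim: "(\<lambda>n. \<phi> n x) \<longlonglongrightarrow> indicat_real {a<..<b} x" for x
    proof (cases "x \<in> {a<..<b}")
      case True
      have "(\<lambda>n. exp (- (1 / real (Suc n)) / (x - a)) * exp (- (1 / real (Suc n)) / (b - x)))
          \<longlonglongrightarrow> exp (- 0 / (x - a)) * exp (- 0 / (b - x))"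
        using True by (intro tendsto_intros LIMSEQ_Suc[OF lim_1_over_n]) auto
      with True show ?thesis by (simp add: \<phi>_def flat_exp_def)
    next
      case False
      then show ?thesis by (auto simp: \<phi>_def flat_exp_def)
    qed
    have bound: "\<bar>\<phi> n x\<bar> \<le> indicat_real {a..b} x" for n x
      by (auto simp: \<phi>_def flat_exp_def indicator_def abs_mult intro!: mult_le_one)
    have "(\<lambda>n. LINT x|lborel. \<phi> n x *\<^sub>R h x) \<longlonglongrightarrow> (LINT x|lborel. indicat_real {a<..<b} x *\<^sub>R h x)"
    proof (rule integral_dominated_convergence[where w = "\<lambda>x. norm (indicat_real {a..b} x *\<^sub>R h x)"])
      show "integrable lborel (\<lambda>x. norm (indicat_real {a..b} x *\<^sub>R h x))"
        using int by (rule integrable_norm)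
      show "AE x in lborel. norm (\<phi> n x *\<^sub>R h x) \<le> norm (indicat_real {a..b} x *\<^sub>R h x)" for n
        using bound by (auto intro!: mult_right_mono)
    qed (auto intro!: tendsto_intros lim)
    then have "(LINT x|lborel. indicat_real {a<..<b} x *\<^sub>R h x) = 0"
      by (simp add: zero[OF test] LIMSEQ_const_iff)
    also have "(LINT x|lborel. indicat_real {a<..<b} x *\<^sub>R h x)
        = (LINT x|lborel. indicat_real {a..b} x *\<^sub>R h x)"
    proof (rule integral_cong_AE)
      show "AE x in lborel. indicat_real {a<..<b} x *\<^sub>R h x = indicat_real {a..b} x *\<^sub>R h x"
        using AE_lborel_singleton[of a] AE_lborel_singleton[of b]
        by eventually_elim (auto simp: indicator_def)
    qed auto
    finally show ?thesis .
  qed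
  \<comment> \<open>The passage from set integrals to the function itself needs integrability on the
    whole line, so it is made for each truncation of \<open>h\<close>; the countably many
    exceptional null sets are united afterwards.\<close>
  have "AE x in lborel. indicat_real {- real N..real N} x *\<^sub>R h x = 0" for N
  proof (rule sigma_finite_measure.density_zero[OF lborel.sigma_finite_measure_axioms int])
    let ?h = "\<lambda>x. indicat_real {- real N..real N} x *\<^sub>R h x"
    fix A :: "real set"
    assume "A \<in> sets lborel"
    then have "A \<in> sets borel" by simp
    then show "set_lebesgue_integral lborel A ?h = 0"
    proof (induction rule: borel_set_induct)
      case empty
      then show ?case by (simp add: set_lebesgue_integral_def)
    next
      case (interval a b)
      have "indicat_real {a..b} x *\<^sub>R ?h x = indicat_real {max a (- real N)..min b (real N)} x *\<^sub>R h x" for x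
        by (auto simp: indicator_def)
      then show ?case unfolding set_lebesgue_integral_def by (simp only: Icc)
    next
      case (compl A)
      have "set_lebesgue_integral lborel (- A) ?h = (LINT x|lborel. ?h x - indicat_real A x *\<^sub>R ?h x)"
        unfolding set_lebesgue_integral_def by (intro Bochner_Integration.integral_cong) (auto simp: indicator_def)
      also have "\<dots> = (LINT x|lborel. ?h x) - set_lebesgue_integral lborel A ?h"
        unfolding set_lebesgue_integral_def using compl(1)
        by (intro Bochner_Integration.integral_diff int integrable_mult_indicator) auto
      finally show ?case using compl Icc by simp
    next
      case (union f)
      have "set_lebesgue_integral lborel (\<Union>i. f i) ?h = (\<Sum>i. set_lebesgue_integral lborel (f i) ?h)"
      proof (rule lebesgue_integral_countable_add)
        have "(\<Union>i. f i) \<in> sets lborel" using union(2) by auto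
        then show "set_integrable lborel (\<Union>i. f i) ?h"
          unfolding set_integrable_def by (intro integrable_mult_indicator int)
      qed (use union(1,2) in \<open>auto simp: disjoint_family_on_def\<close>)
      then show ?case using union by simp
    qed
  qed
  then have "AE x in lborel. \<forall>N. indicat_real {- real N..real N} x *\<^sub>R h x = 0"
    unfolding AE_all_countable by blast
  then show ?thesis
  proof eventually_elim
    case (elim x)
    obtain N where "\<bar>x\<bar> \<le> real N" using real_arch_simple by blast
    with elim[rule_format, of N] show ?case by (auto simp: indicator_def)
  qed
qed

section \<open>Integration against test functions\<close>

lemma test_function_vanishes:
  assumes "test_function \<phi>"
  obtains M where "M \<ge> 0" "\<And>x. \<bar>x\<bar> > M \<Longrightarrow> \<phi> x = 0"
proof -
  have "bounded {x. \<phi> x \<noteq> 0}"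
    using assms bounded_subset[OF compact_imp_bounded closure_subset] by (simp add: test_function_def)
  then obtain M where "\<And>x. \<phi> x \<noteq> 0 \<Longrightarrow> \<bar>x\<bar> \<le> M" unfolding bounded_iff by auto
  then have "\<bar>x\<bar> > max M 0 \<Longrightarrow> \<phi> x = 0" for x by force
  then show ?thesis using that[of "max M 0"] by auto
qed

lemma test_function_has_derivative:
  assumes "test_function \<phi>"
  shows "((deriv ^^ n) \<phi> has_real_derivative (deriv ^^ Suc n) \<phi> x) (at x)"
  using assms by (auto simp: test_function_def DERIV_deriv_iff_field_differentiable)

lemma test_function_deriv:
  assumes "test_function \<phi>"
  shows "test_function (deriv \<phi>)"
  unfolding test_function_def
proof (intro conjI allI)
  show "(deriv ^^ n) (deriv \<phi>) field_differentiable at x" for n x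
    using test_function_has_derivative[OF assms, of "Suc n" x]
    by (auto simp: funpow_swap1 field_differentiable_def)
  obtain M where M: "\<And>x. \<bar>x\<bar> > M \<Longrightarrow> \<phi> x = 0" using test_function_vanishes[OF assms] by blast
  have "deriv \<phi> x = 0" if "\<bar>x\<bar> > M" for x
  proof -
    have "open {y::real. \<bar>y\<bar> > M}" by (intro open_Collect_less continuous_intros)
    then have "eventually (\<lambda>y. \<phi> y = 0) (nhds x)"
      using eventually_nhds_in_open[of "{y::real. \<bar>y\<bar> > M}" x] that M by (auto elim: eventually_mono)
    from deriv_cong_ev[OF this refl] show ?thesis by simp
  qed
  then have "{x. deriv \<phi> x \<noteq> 0} \<subseteq> {-M..M}" by force
  then have "bounded {x. deriv \<phi> x \<noteq> 0}" by (rule bounded_subset[OF bounded_closed_interval])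
  then show "compact (closure {x. deriv \<phi> x \<noteq> 0})" by simp
qed

lemma test_function_integrable:
  assumes "test_function \<phi>" "locally_integrable g"
  shows "integrable lborel (\<lambda>x. \<phi> x *\<^sub>R g x)"
proof -
  obtain M where M: "\<And>x. \<bar>x\<bar> > M \<Longrightarrow> \<phi> x = 0" using test_function_vanishes[OF assms(1)] by blast
  have cont: "continuous_on UNIV \<phi>"
    using test_function_has_derivative[OF assms(1), of 0]
    by (auto intro!: continuous_at_imp_continuous_on DERIV_isCont)
  have [measurable]: "\<phi> \<in> borel_measurable borel" "g \<in> borel_measurable borel"
    using cont locally_integrable_borel_measurable[OF assms(2)] by (auto intro: borel_measurable_continuous_onI)
  obtain B where B: "\<And>x. \<bar>x\<bar> \<le> M \<Longrightarrow> \<bar>\<phi> x\<bar> \<le> B"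
    using compact_imp_bounded[OF compact_continuous_image[OF continuous_on_subset[OF cont] compact_Icc[of "-M" M]]]
    by (fastforce simp: bounded_iff abs_le_iff)
  have "integrable lborel (\<lambda>x. B *\<^sub>R (indicat_real {-M..M} x *\<^sub>R g x))"
    using assms(2) unfolding locally_integrable_def set_integrable_def by (intro integrable_scaleR_right) auto
  then show ?thesis
  proof (rule Bochner_Integration.integrable_bound)
    show "AE x in lborel. norm (\<phi> x *\<^sub>R g x) \<le> norm (B *\<^sub>R indicat_real {- M..M} x *\<^sub>R g x)"
    proof (intro AE_I2)
      fix x
      show "norm (\<phi> x *\<^sub>R g x) \<le> norm (B *\<^sub>R indicat_real {- M..M} x *\<^sub>R g x)"
        using M[of x] B[of x] by (cases "\<bar>x\<bar> \<le> M") (auto simp: indicator_def intro!: mult_right_mono)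
    qed
  qed simp
qed

text \<open>The fundamental lemma applies to \<open>g - g'\<close>: after cancelling
  \<open>(- 1) ^ j\<close>, both functions have the same integral against every test
  function.\<close>

lemma weak_deriv_unique:
  assumes "has_weak_deriv j f g" "has_weak_deriv j f g'"
  shows "AE x in lborel. g x = g' x"
proof -
  have li: "locally_integrable g" "locally_integrable g'"
    using assms by (auto simp: has_weak_deriv_def)
  have "AE x in lborel. g x - g' x = 0"
  proof (rule weakly_zero_imp_AE_zero)
    show "locally_integrable (\<lambda>x. g x - g' x)"
      using li unfolding locally_integrable_def set_integrable_def
      by (auto simp: scaleR_diff_right)
    fix \<phi> assume \<phi>: "test_function \<phi>"
    have "(- 1) ^ j * (LINT x|lborel. \<phi> x *\<^sub>R g x) = (- 1) ^ j * (LINT x|lborel. \<phi> x *\<^sub>R g' x)"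
      using assms \<phi> unfolding has_weak_deriv_def by metis
    then show "(LINT x|lborel. \<phi> x *\<^sub>R (g x - g' x)) = 0"
      using test_function_integrable[OF \<phi>] li by (simp add: scaleR_diff_right)
  qed
  then show ?thesis by simp
qed

text \<open>\<open>weak_deriv\<close> is an arbitrary choice; by uniqueness the Sobolev norm may be
  computed from any explicit weak derivative.\<close>

lemma integral_weak_deriv:
  assumes "has_weak_deriv j f g"
  shows "(LINT x|lborel. (norm (weak_deriv j f x))\<^sup>2) = (LINT x|lborel. (norm (g x))\<^sup>2)"
proof -
  have w: "has_weak_deriv j f (weak_deriv j f)"
    unfolding weak_deriv_def using assms by (rule someI[of "has_weak_deriv j f"])
  note [measurable] =
    locally_integrable_borel_measurable[OF w[unfolded has_weak_deriv_def, THEN conjunct2, THEN conjunct1]]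
    locally_integrable_borel_measurable[OF assms[unfolded has_weak_deriv_def, THEN conjunct2, THEN conjunct1]]
  show ?thesis
    by (rule integral_cong_AE) (use weak_deriv_unique[OF w assms] in \<open>auto\<close>)
qed

lemma integration_by_parts_test_function:
  assumes \<phi>: "test_function \<phi>"
    and f: "\<And>x. (f has_vector_derivative f' x) (at x)" and f': "continuous_on UNIV f'"
  shows "(LINT x|lborel. deriv \<phi> x *\<^sub>R f x) = - (LINT x|lborel. \<phi> x *\<^sub>R (f' x :: complex))"
proof -
  obtain M where M: "M \<ge> 0" "\<And>x. \<bar>x\<bar> > M \<Longrightarrow> \<phi> x = 0" using test_function_vanishes[OF \<phi>] by blast
  obtain M' where M': "M' \<ge> 0" "\<And>x. \<bar>x\<bar> > M' \<Longrightarrow> deriv \<phi> x = 0"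
    using test_function_vanishes[OF test_function_deriv[OF \<phi>]] by blast
  \<comment> \<open>Strictly beyond the bounds for both \<open>\<phi>\<close> and
    \<open>deriv \<phi>\<close>: the boundary terms vanish and truncation to \<open>{-R..R}\<close>
    loses nothing.\<close>
  define R where "R = M + M' + 1"
  have \<phi>': "(\<phi> has_real_derivative deriv \<phi> x) (at x)" for x
    using test_function_has_derivative[OF \<phi>, of 0] by simp
  have cont: "continuous_on UNIV f" "continuous_on UNIV \<phi>" "continuous_on UNIV (deriv \<phi>)"
    using has_vector_derivative_continuous[OF f] DERIV_isCont[OF \<phi>']
      DERIV_isCont[OF test_function_has_derivative[OF \<phi>, of 1]]
    by (auto intro!: continuous_at_imp_continuous_on)
  have "(LINT x|lborel. indicat_real {-R..R} x *\<^sub>R (deriv \<phi> x *\<^sub>R f x + \<phi> x *\<^sub>R f' x))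
      = \<phi> R *\<^sub>R f R - \<phi> (-R) *\<^sub>R f (-R)"
  proof (rule integral_FTC_Icc)
    show "- R \<le> R" using M M' by (simp add: R_def)
    show "continuous_on {- R..R} (\<lambda>x. deriv \<phi> x *\<^sub>R f x + \<phi> x *\<^sub>R f' x)"
      using cont f' by (intro continuous_intros) (auto intro: continuous_on_subset)
    show "((\<lambda>x. \<phi> x *\<^sub>R f x) has_vector_derivative deriv \<phi> x *\<^sub>R f x + \<phi> x *\<^sub>R f' x) (at x within {- R..R})" for x
      using has_vector_derivative_scaleR[OF \<phi>' f, THEN has_vector_derivative_at_within]
      by (simp add: add.commute)
  qed
  also have "\<dots> = 0" using M(1) M'(1) by (simp add: M(2) R_def)
  also have "(\<lambda>x. indicat_real {-R..R} x *\<^sub>R (deriv \<phi> x *\<^sub>R f x + \<phi> x *\<^sub>R f' x))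
      = (\<lambda>x. deriv \<phi> x *\<^sub>R f x + \<phi> x *\<^sub>R f' x)"
  proof
    fix x
    show "indicat_real {-R..R} x *\<^sub>R (deriv \<phi> x *\<^sub>R f x + \<phi> x *\<^sub>R f' x)
      = deriv \<phi> x *\<^sub>R f x + \<phi> x *\<^sub>R f' x"
      using M(1) M'(1) M(2)[of x] M'(2)[of x]
      by (cases "\<bar>x\<bar> \<le> R") (auto simp: R_def indicator_def)
  qed
  finally have "(LINT x|lborel. deriv \<phi> x *\<^sub>R f x + \<phi> x *\<^sub>R f' x) = 0" .
  then show ?thesis
    using \<phi> test_function_deriv[OF \<phi>] cont f'
    by (simp add: test_function_integrable continuous_imp_locally_integrable eq_neg_iff_add_eq_0)
qed

text \<open>The derivatives are moved one at a time: the induction hypothesis is applied to the test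
  function \<open>deriv \<phi>\<close>, and one integration by parts removes the remaining
  derivative.\<close>

lemma has_weak_deriv_classical:
  assumes f: "\<And>j x. (f j has_vector_derivative f (Suc j) x) (at x)"
  shows "has_weak_deriv j (f 0) (f j)"
proof -
  have cont: "continuous_on UNIV (f j)" for j
    using f by (auto intro!: continuous_at_imp_continuous_on has_vector_derivative_continuous)
  have "(LINT x|lborel. (deriv ^^ j) \<phi> x *\<^sub>R f i x) = (- 1) ^ j * (LINT x|lborel. \<phi> x *\<^sub>R f (i + j) x)"
    if "test_function \<phi>" for \<phi> i
    using that
  proof (induction j arbitrary: \<phi>)
    case (Suc j)
    show ?case
      using Suc.IH[OF test_function_deriv[OF Suc.prems]]
        integration_by_parts_test_function[OF Suc.prems f cont, of "i + j"]
      by (simp add: funpow_swap1)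
  qed simp
  from this[where i = 0] show ?thesis
    using cont by (auto simp: has_weak_deriv_def continuous_imp_locally_integrable)
qed


section \<open>The difference of the solitons\<close>

locale soliton_parameters =
  fixes c \<omega> :: real
  assumes c_nonneg: "c \<ge> 0" and omega_pos: "\<omega> > 0" and speed_bound: "c\<^sup>2 < 4 * \<omega>"
begin

section \<open>Coefficients of the profile up to \<open>\<epsilon> = 0\<close>\<close>

definition "a = sqrt (4 * \<omega> - c\<^sup>2)"
definition "s = c\<^sup>2 - 2 * \<omega>"
definition "r \<epsilon> = sqrt (1 + s * \<epsilon> + \<omega>\<^sup>2 * \<epsilon>\<^sup>2)"
definition "A \<epsilon> = sqrt (2 * r \<epsilon> + 2 + s * \<epsilon>)"

text \<open>Rationalised forms of \<open>(r - 1) / \<epsilon>\<close>, of \<open>(A - 2) / \<epsilon>\<close> and of the coefficient of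
  \<open>sinh\<close> divided by \<open>\<epsilon>\<close>: unlike the quotients, they are continuous up to \<open>\<epsilon> = 0\<close>.\<close>

definition "\<gamma> \<epsilon> = (s + \<omega>\<^sup>2 * \<epsilon>) / (r \<epsilon> + 1)"
definition "\<alpha> \<epsilon> = (2 * \<gamma> \<epsilon> + s) / (A \<epsilon> + 2)"
definition "\<beta> \<epsilon> = c * a / A \<epsilon>"

definition "S y = 1 / cosh (a / 2 * y)"
definition "T y = tanh (a / 2 * y)"
definition "E \<epsilon> y = 1 / (2 * r \<epsilon> + (1 + \<omega> * \<epsilon> - r \<epsilon>) * (S y)\<^sup>2)"

text \<open>Including 0 makes the limit a member of the family, so that convergence as
  \<open>\<epsilon>\<close> decreases to 0 becomes continuity on \<open>I\<close>.\<close>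

abbreviation "I \<equiv> {0..<1 / \<omega>}"

lemma a_pos: "a > 0"
  using speed_bound by (simp add: a_def)

lemma a_square: "a\<^sup>2 = 4 * \<omega> - c\<^sup>2"
  using speed_bound by (simp add: a_def)

text \<open>The radicand equals
  \<open>(1 - \<omega> * \<epsilon>)\<^sup>2 + c\<^sup>2 * \<epsilon>\<close>.\<close>

lemma r_ge: "\<epsilon> \<ge> 0 \<Longrightarrow> r \<epsilon> \<ge> 1 - \<omega> * \<epsilon>"
  unfolding r_def by (rule real_le_rsqrt) (simp add: s_def power2_eq_square algebra_simps)

lemma r_pos: "\<epsilon> \<in> I \<Longrightarrow> r \<epsilon> > 0"
  using r_ge[of \<epsilon>] omega_pos by (auto simp: field_simps)

lemma r_square: "\<epsilon> \<in> I \<Longrightarrow> (r \<epsilon>)\<^sup>2 = 1 + s * \<epsilon> + \<omega>\<^sup>2 * \<epsilon>\<^sup>2"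
  using r_pos[of \<epsilon>] unfolding r_def by simp

lemma A_radicand_pos:
  assumes "\<epsilon> \<in> I"
  shows "2 + s * \<epsilon> > 0"
proof -
  have "\<omega> * \<epsilon> < 1" using assms omega_pos by (auto simp: field_simps)
  moreover have "c\<^sup>2 * \<epsilon> \<ge> 0" using assms by simp
  ultimately show ?thesis by (simp add: s_def left_diff_distrib)
qed

lemma A_pos: "\<epsilon> \<in> I \<Longrightarrow> A \<epsilon> > 0"
  using A_radicand_pos[of \<epsilon>] r_pos[of \<epsilon>] by (auto simp: A_def intro: add_pos_pos)

lemma A_square: "\<epsilon> \<in> I \<Longrightarrow> (A \<epsilon>)\<^sup>2 = 2 * r \<epsilon> + 2 + s * \<epsilon>"
  using A_radicand_pos[of \<epsilon>] r_pos[of \<epsilon>] by (auto simp: A_def)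

lemma r_eq: "\<epsilon> \<in> I \<Longrightarrow> r \<epsilon> = 1 + \<epsilon> * \<gamma> \<epsilon>"
  using r_pos[of \<epsilon>] r_square[of \<epsilon>] by (simp add: \<gamma>_def field_simps power2_eq_square)

text \<open>\<open>(A \<epsilon>)\<^sup>2 - 4 = 2 * (r \<epsilon> - 1) + s * \<epsilon>\<close>,
  where \<open>r_eq\<close> exhibits the factor \<open>\<epsilon>\<close>; division by
  \<open>A \<epsilon> + 2\<close> gives \<open>\<alpha>\<close>.\<close>

lemma A_eq: "\<epsilon> \<in> I \<Longrightarrow> A \<epsilon> = 2 + \<epsilon> * \<alpha> \<epsilon>"
  using A_pos[of \<epsilon>] A_square[of \<epsilon>] r_eq[of \<epsilon>] by (simp add: \<alpha>_def field_simps power2_eq_square)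

text \<open>The product of the radicands of the coefficients of \<open>cosh\<close> and \<open>sinh\<close> is the square
  of \<open>\<epsilon> * c * a\<close>.\<close>

lemma sinh_coefficient_eq:
  assumes "\<epsilon> \<in> I"
  shows "sgn c * sqrt (2 * r \<epsilon> - 2 + (2 * \<omega> - c\<^sup>2) * \<epsilon>) = \<epsilon> * \<beta> \<epsilon>"
proof (cases "c = 0")
  case False
  have "(2 * r \<epsilon> - 2 + (2 * \<omega> - c\<^sup>2) * \<epsilon>) * (A \<epsilon>)\<^sup>2 = 4 * (r \<epsilon>)\<^sup>2 - (2 + s * \<epsilon>)\<^sup>2"
    unfolding A_square[OF assms] s_def by (simp add: power2_eq_square algebra_simps)
  also have "\<dots> = \<epsilon>\<^sup>2 * (c\<^sup>2 * a\<^sup>2)"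
    unfolding r_square[OF assms] a_square s_def by (simp add: power2_eq_square algebra_simps)
  finally have "2 * r \<epsilon> - 2 + (2 * \<omega> - c\<^sup>2) * \<epsilon> = (\<epsilon> * \<beta> \<epsilon>)\<^sup>2"
    using A_pos[OF assms] by (simp add: \<beta>_def field_simps)
  moreover have "\<epsilon> * \<beta> \<epsilon> \<ge> 0"
    using assms A_pos[OF assms] c_nonneg a_pos by (simp add: \<beta>_def)
  ultimately show ?thesis using False c_nonneg by simp
next
  case True
  then show ?thesis unfolding \<beta>_def by simp
qed

lemma continuous_coefficients:
  "continuous_on I r" "continuous_on I \<alpha>" "continuous_on I \<beta>" "continuous_on I \<gamma>"
proof -
  show r: "continuous_on I r" unfolding r_def by (intro continuous_intros)
  have A: "continuous_on I A" unfolding A_def by (intro continuous_intros r)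
  show \<gamma>: "continuous_on I \<gamma>" unfolding \<gamma>_def
    by (intro continuous_intros r) (use r_pos in \<open>force\<close>)
  show "continuous_on I \<alpha>" unfolding \<alpha>_def
    by (intro continuous_intros A \<gamma>) (use A_pos in \<open>force\<close>)
  show "continuous_on I \<beta>" unfolding \<beta>_def
    by (intro continuous_intros A) (use A_pos in \<open>force\<close>)
qed

section \<open>Bounds and derivatives of \<open>S\<close>, \<open>T\<close> and
  \<open>E\<close>\<close>

lemma S_pos: "S y > 0" and S_le_1: "S y \<le> 1"
  by (auto simp: S_def cosh_real_pos cosh_real_ge_1)

lemma abs_T_le_1: "\<bar>T y\<bar> \<le> 1"
  using tanh_real_bounds[of "a / 2 * y"] by (auto simp: T_def)

text \<open>One of the two copies of \<open>r \<epsilon>\<close> absorbs the term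
  \<open>- r \<epsilon> * (S y)\<^sup>2\<close>, because \<open>S\<close> is at most 1; the rest of
  the second summand is nonnegative.\<close>

lemma denominator_ge:
  assumes "\<epsilon> \<in> I"
  shows "r \<epsilon> \<le> 2 * r \<epsilon> + (1 + \<omega> * \<epsilon> - r \<epsilon>) * (S y)\<^sup>2"
proof -
  have "(S y)\<^sup>2 \<le> 1" using S_pos[of y] S_le_1[of y] by (simp add: power_le_one)
  then have "r \<epsilon> * (S y)\<^sup>2 \<le> r \<epsilon> * 1" using r_pos[OF assms] by (intro mult_left_mono) auto
  moreover have "(1 + \<omega> * \<epsilon>) * (S y)\<^sup>2 \<ge> 0" using assms omega_pos by simp
  ultimately show ?thesis by (simp add: algebra_simps)
qed

lemma E_pos: "\<epsilon> \<in> I \<Longrightarrow> E \<epsilon> y > 0" and E_le: "\<epsilon> \<in> I \<Longrightarrow> E \<epsilon> y \<le> 1 / r \<epsilon>"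
  using denominator_ge[of \<epsilon> y] r_pos[of \<epsilon>] by (auto simp: E_def intro: divide_left_mono)

lemma S_has_derivative: "(S has_real_derivative - (a / 2) * S y * T y) (at y)"
  unfolding S_def T_def
  by (auto intro!: derivative_eq_intros simp: tanh_def cosh_real_nonzero field_simps power2_eq_square)

lemma T_has_derivative: "(T has_real_derivative (a / 2) * (S y)\<^sup>2) (at y)"
proof -
  have "1 - (tanh (a / 2 * y))\<^sup>2 = (S y)\<^sup>2"
    unfolding S_def tanh_def using hyperbolic_pythagoras[of "a / 2 * y"]
    by (simp add: diff_divide_eq_iff power_divide)
  then show ?thesis
    unfolding T_def by (auto intro!: derivative_eq_intros)
qed

lemma E_has_derivative:
  assumes "\<epsilon> \<in> I"
  shows "(E \<epsilon> has_real_derivative (1 + \<omega> * \<epsilon> - r \<epsilon>) * a * (E \<epsilon> y)\<^sup>2 * (S y)\<^sup>2 * T y) (at y)"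
proof -
  have "2 * r \<epsilon> + (1 + \<omega> * \<epsilon> - r \<epsilon>) * (S y)\<^sup>2 \<noteq> 0"
    using denominator_ge[OF assms, of y] r_pos[OF assms] by simp
  then show ?thesis
    unfolding E_def
    by (auto intro!: derivative_eq_intros S_has_derivative simp: field_simps power2_eq_square)
qed

section \<open>An algebra of profiles stable under differentiation\<close>

text \<open>Closure under differentiation in \<open>y\<close>, continuity in
  \<open>\<epsilon>\<close> and boundedness each follow by induction over these generators.
  Constants, the carrier and \<open>T\<close> do not decay, so the factor \<open>S\<close> that
  gives square integrability is carried outside.\<close>

inductive_set profile_algebra :: "(real \<Rightarrow> real \<Rightarrow> complex) set" where
    coefficient: "continuous_on I p \<Longrightarrow> (\<lambda>\<epsilon> y. p \<epsilon>) \<in> profile_algebra"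
  | carrier: "(\<lambda>\<epsilon> y. exp (\<i> * of_real (c * y / 2))) \<in> profile_algebra"
  | S: "(\<lambda>\<epsilon> y. of_real (S y)) \<in> profile_algebra"
  | T: "(\<lambda>\<epsilon> y. of_real (T y)) \<in> profile_algebra"
  | E: "(\<lambda>\<epsilon> y. of_real (E \<epsilon> y)) \<in> profile_algebra"
  | add: "f \<in> profile_algebra \<Longrightarrow> g \<in> profile_algebra \<Longrightarrow> (\<lambda>\<epsilon> y. f \<epsilon> y + g \<epsilon> y) \<in> profile_algebra"
  | mult: "f \<in> profile_algebra \<Longrightarrow> g \<in> profile_algebra \<Longrightarrow> (\<lambda>\<epsilon> y. f \<epsilon> y * g \<epsilon> y) \<in> profile_algebra"

lemma profile_algebra_real_coefficient:
  "continuous_on I p \<Longrightarrow> (\<lambda>\<epsilon> y. of_real (p \<epsilon>)) \<in> profile_algebra"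
  by (intro profile_algebra.coefficient continuous_on_of_real)

text \<open>The derivative of each generator is a polynomial in the generators. A single
  \<open>f'\<close> serves all \<open>\<epsilon>\<close>, so the derivative again depends
  continuously on \<open>\<epsilon>\<close>.\<close>

lemma profile_algebra_derivative:
  assumes "f \<in> profile_algebra"
  shows "\<exists>f' \<in> profile_algebra. \<forall>\<epsilon>\<in>I. \<forall>y. (f \<epsilon> has_vector_derivative f' \<epsilon> y) (at y)"
  using assms
proof induction
  case (coefficient p)
  have "(\<lambda>\<epsilon> y. 0) \<in> profile_algebra" by (intro profile_algebra.coefficient continuous_on_const)
  then show ?case by (intro bexI[of _ "\<lambda>\<epsilon> y. 0"]) auto
next
  case carrier
  have "((\<lambda>y. exp (\<i> * of_real (c * y / 2))) has_vector_derivative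
      (\<i> * of_real (c / 2)) * exp (\<i> * of_real (c * y / 2))) (at y)" for y
  proof -
    have "((\<lambda>z. exp (\<i> * (c * z / 2))) has_field_derivative
        (\<i> * of_real (c / 2)) * exp (\<i> * (c * of_real y / 2))) (at (of_real y))"
      by (auto intro!: derivative_eq_intros)
    from has_vector_derivative_real_field[OF this] show ?thesis by simp
  qed
  moreover have "(\<lambda>\<epsilon> y. (\<i> * of_real (c / 2)) * exp (\<i> * of_real (c * y / 2))) \<in> profile_algebra"
    by (intro profile_algebra.mult[OF profile_algebra.coefficient] profile_algebra.carrier continuous_on_const)
  ultimately show ?case by (intro bexI[of _ "\<lambda>\<epsilon> y. (\<i> * of_real (c / 2)) * exp (\<i> * of_real (c * y / 2))"]) auto
next
  case S
  let ?f = "\<lambda>(\<epsilon>::real) y. of_real (- (a / 2)) * complex_of_real (S y) * complex_of_real (T y)"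
  have "?f \<in> profile_algebra"
    by (intro profile_algebra.intros continuous_on_const)
  moreover have "((\<lambda>y. complex_of_real (S y)) has_vector_derivative ?f \<epsilon> y) (at y)" for \<epsilon> y
    unfolding of_real_mult[symmetric] by (rule has_vector_derivative_of_real[OF S_has_derivative])
  ultimately show ?case by (intro bexI[of _ ?f]) auto
next
  case T
  let ?f = "\<lambda>(\<epsilon>::real) y. of_real (a / 2) * (complex_of_real (S y) * complex_of_real (S y))"
  have "?f \<in> profile_algebra"
    by (intro profile_algebra.intros continuous_on_const)
  moreover have "((\<lambda>y. complex_of_real (T y)) has_vector_derivative ?f \<epsilon> y) (at y)" for \<epsilon> y
    unfolding of_real_mult[symmetric]
    by (rule has_vector_derivative_of_real[OF T_has_derivative[unfolded power2_eq_square]])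
  ultimately show ?case by (intro bexI[of _ ?f]) auto
next
  case E
  let ?f = "\<lambda>\<epsilon> y. of_real ((1 + \<omega> * \<epsilon> - r \<epsilon>) * a) * (complex_of_real (E \<epsilon> y) * complex_of_real (E \<epsilon> y))
      * (complex_of_real (S y) * complex_of_real (S y)) * complex_of_real (T y)"
  have "?f \<in> profile_algebra"
    by (intro profile_algebra.mult profile_algebra.S profile_algebra.T profile_algebra.E
        profile_algebra_real_coefficient continuous_intros continuous_coefficients)
  moreover have "((\<lambda>y. complex_of_real (E \<epsilon> y)) has_vector_derivative ?f \<epsilon> y) (at y)" if "\<epsilon> \<in> I" for \<epsilon> y
    using has_vector_derivative_of_real[OF E_has_derivative[OF that]] by (simp add: power2_eq_square)
  ultimately show ?case by (intro bexI[of _ ?f]) auto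
next
  case (add f g)
  then obtain f' g' where *: "f' \<in> profile_algebra" "g' \<in> profile_algebra"
    "\<forall>\<epsilon>\<in>I. \<forall>y. (f \<epsilon> has_vector_derivative f' \<epsilon> y) (at y)"
    "\<forall>\<epsilon>\<in>I. \<forall>y. (g \<epsilon> has_vector_derivative g' \<epsilon> y) (at y)" by blast
  then show ?case
    by (intro bexI[of _ "\<lambda>\<epsilon> y. f' \<epsilon> y + g' \<epsilon> y"])
      (auto intro!: profile_algebra.add has_vector_derivative_add)
next
  case (mult f g)
  then obtain f' g' where *: "f' \<in> profile_algebra" "g' \<in> profile_algebra"
    "\<forall>\<epsilon>\<in>I. \<forall>y. (f \<epsilon> has_vector_derivative f' \<epsilon> y) (at y)"
    "\<forall>\<epsilon>\<in>I. \<forall>y. (g \<epsilon> has_vector_derivative g' \<epsilon> y) (at y)" by blast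
  with mult.hyps show ?case
    by (intro bexI[of _ "\<lambda>\<epsilon> y. f \<epsilon> y * g' \<epsilon> y + f' \<epsilon> y * g \<epsilon> y"])
      (auto intro!: profile_algebra.add profile_algebra.mult has_vector_derivative_mult)
qed

lemma profile_algebra_continuous:
  assumes "f \<in> profile_algebra"
  shows "continuous_on I (\<lambda>\<epsilon>. f \<epsilon> y)"
  using assms
proof induction
  case E
  have "2 * r \<epsilon> + (1 + \<omega> * \<epsilon> - r \<epsilon>) * (S y)\<^sup>2 \<noteq> 0" if "\<epsilon> \<in> I" for \<epsilon>
    using denominator_ge[OF that, of y] r_pos[OF that] by simp
  then show ?case
    unfolding E_def by (intro continuous_intros continuous_coefficients) auto
qed (auto intro!: continuous_intros)

text \<open>Bounds are uniform only away from \<open>1 / \<omega>\<close>: continuous coefficients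
  are bounded on compact subsets of \<open>I\<close>, and \<open>E\<close> is controlled by
  \<open>1 / r\<close>, where for \<open>c = 0\<close> the root \<open>r\<close> tends to 0 at
  \<open>1 / \<omega>\<close>.\<close>

lemma profile_algebra_bounded:
  assumes "f \<in> profile_algebra" and \<delta>: "\<delta> < 1 / \<omega>"
  shows "\<exists>M. \<forall>\<epsilon>\<in>{0..\<delta>}. \<forall>y. norm (f \<epsilon> y) \<le> M"
  using assms(1)
proof induction
  case (coefficient p)
  have "compact (p ` {0..\<delta>})"
    using \<delta> by (intro compact_continuous_image continuous_on_subset[OF coefficient]) auto
  then show ?case using compact_imp_bounded by (fastforce simp: bounded_iff)
next
  case carrier
  show ?case by (intro exI[of _ 1]) simp
next
  case S
  show ?case using S_pos S_le_1 by (intro exI[of _ 1]) (simp add: abs_of_pos)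
next
  case T
  show ?case using abs_T_le_1 by (intro exI[of _ 1]) simp
next
  case E
  have "norm (complex_of_real (E \<epsilon> y)) \<le> 1 / (1 - \<omega> * \<delta>)" if "\<epsilon> \<in> {0..\<delta>}" for \<epsilon> y
  proof -
    have "\<epsilon> \<in> I" using that \<delta> by auto
    have "1 - \<omega> * \<delta> > 0" using \<delta> omega_pos by (simp add: field_simps)
    moreover have "1 - \<omega> * \<delta> \<le> 1 - \<omega> * \<epsilon>" using that omega_pos by simp
    ultimately have "1 / r \<epsilon> \<le> 1 / (1 - \<omega> * \<delta>)"
      using r_ge[of \<epsilon>] that by (intro divide_left_mono) (auto intro!: mult_pos_pos)
    then show ?thesis using E_pos[OF \<open>\<epsilon> \<in> I\<close>, of y] E_le[OF \<open>\<epsilon> \<in> I\<close>, of y] by simp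
  qed
  then show ?case by blast
next
  case (add f g)
  then obtain M N where "\<forall>\<epsilon>\<in>{0..\<delta>}. \<forall>y. norm (f \<epsilon> y) \<le> M" "\<forall>\<epsilon>\<in>{0..\<delta>}. \<forall>y. norm (g \<epsilon> y) \<le> N"
    by blast
  then show ?case by (intro exI[of _ "M + N"]) (auto intro!: norm_add_rule_thm)
next
  case (mult f g)
  then obtain M N where *: "\<forall>\<epsilon>\<in>{0..\<delta>}. \<forall>y. norm (f \<epsilon> y) \<le> M" "\<forall>\<epsilon>\<in>{0..\<delta>}. \<forall>y. norm (g \<epsilon> y) \<le> N"
    by blast
  have "norm (f \<epsilon> y * g \<epsilon> y) \<le> M * N" if "\<epsilon> \<in> {0..\<delta>}" for \<epsilon> y
  proof -
    have "norm (f \<epsilon> y) \<le> M" "norm (g \<epsilon> y) \<le> N" using * that by auto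
    moreover from this have "0 \<le> M" by (meson norm_ge_zero order_trans)
    ultimately show ?thesis unfolding norm_mult by (intro mult_mono) auto
  qed
  then show ?case by blast
qed

section \<open>Square integrability and convergence of energies\<close>

text \<open>\<open>T\<close> is a primitive of \<open>a / 2 * (S y)\<^sup>2\<close> with finite
  limits at both ends of the line.\<close>

lemma integrable_S_square: "integrable lborel (\<lambda>y. (S y)\<^sup>2)"
proof -
  have "set_integrable lborel (einterval (-\<infinity>) \<infinity>) (\<lambda>y. a / 2 * (S y)\<^sup>2)"
  proof (rule interval_integral_FTC_nonneg(1)[where F = T])
    have lim: "filterlim (\<lambda>y. a / 2 * y) at_top at_top"
      using a_pos by (intro filterlim_tendsto_pos_mult_at_top[OF tendsto_const]) (auto simp: filterlim_ident)
    show "((T \<circ> real_of_ereal) \<longlongrightarrow> 1) (at_left \<infinity>)"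
      unfolding ereal_tendsto_simps1 T_def by (rule filterlim_compose[OF tanh_real_at_top lim])
    have lim: "filterlim (\<lambda>y. a / 2 * y) at_bot at_bot"
      using a_pos by (intro filterlim_tendsto_pos_mult_at_bot[OF tendsto_const]) (auto simp: filterlim_ident)
    show "((T \<circ> real_of_ereal) \<longlongrightarrow> - 1) (at_right (- \<infinity>))"
      unfolding ereal_tendsto_simps1 T_def by (rule filterlim_compose[OF tanh_real_at_bot lim])
    show "isCont (\<lambda>y. a / 2 * (S y)\<^sup>2) y" for y
      by (intro continuous_intros DERIV_isCont[OF S_has_derivative])
  qed (use T_has_derivative a_pos in auto)
  then have "integrable lborel (\<lambda>y. a / 2 * (S y)\<^sup>2)"
    by (simp add: set_integrable_def einterval_def)
  from integrable_mult_right[OF this, of "2 / a"] show ?thesis using a_pos by simp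
qed

definition "profile_energy f \<epsilon> = (LINT y|lborel. (norm (of_real (S y) * f \<epsilon> y))\<^sup>2)"

lemma continuous_S_times_profile:
  assumes "f \<in> profile_algebra" "\<epsilon> \<in> I"
  shows "continuous_on UNIV (\<lambda>y. of_real (S y) * f \<epsilon> y)"
proof -
  obtain f' where "\<forall>\<epsilon>\<in>I. \<forall>y. (f \<epsilon> has_vector_derivative f' \<epsilon> y) (at y)"
    using profile_algebra_derivative[OF assms(1)] by blast
  then have "isCont (f \<epsilon>) y" for y using assms(2) has_vector_derivative_continuous by blast
  moreover have "isCont S y" for y by (rule DERIV_isCont[OF S_has_derivative])
  ultimately show ?thesis
    by (intro continuous_intros continuous_at_imp_continuous_on ballI) auto
qed

lemma S_times_profile_dominated:
  assumes "f \<in> profile_algebra" "\<delta> < 1 / \<omega>"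
  shows "\<exists>M. \<forall>\<epsilon>\<in>{0..\<delta>}. \<forall>y. (norm (of_real (S y) * f \<epsilon> y))\<^sup>2 \<le> M * (S y)\<^sup>2"
proof -
  obtain M where M: "\<forall>\<epsilon>\<in>{0..\<delta>}. \<forall>y. norm (f \<epsilon> y) \<le> M"
    using profile_algebra_bounded[OF assms] by blast
  have "(norm (of_real (S y) * f \<epsilon> y))\<^sup>2 \<le> M\<^sup>2 * (S y)\<^sup>2" if "\<epsilon> \<in> {0..\<delta>}" for \<epsilon> y
    using M that by (auto simp: norm_mult power_mult_distrib mult.commute intro!: mult_right_mono power_mono)
  then show ?thesis by blast
qed

lemma integrable_S_times_profile:
  assumes "f \<in> profile_algebra" "\<epsilon> \<in> I"
  shows "integrable lborel (\<lambda>y. (norm (of_real (S y) * f \<epsilon> y))\<^sup>2)"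
proof -
  obtain M where M: "\<forall>y. (norm (of_real (S y) * f \<epsilon> y))\<^sup>2 \<le> M * (S y)\<^sup>2"
    using S_times_profile_dominated[OF assms(1), of \<epsilon>] assms(2) by fastforce
  have [measurable]: "(\<lambda>y. of_real (S y) * f \<epsilon> y) \<in> borel_measurable borel"
    by (rule borel_measurable_continuous_onI[OF continuous_S_times_profile[OF assms]])
  show ?thesis
  proof (rule Bochner_Integration.integrable_bound)
    show "integrable lborel (\<lambda>y. M * (S y)\<^sup>2)" by (intro integrable_mult_right integrable_S_square)
    show "AE y in lborel. norm ((norm (of_real (S y) * f \<epsilon> y))\<^sup>2) \<le> norm (M * (S y)\<^sup>2)"
      using M by (intro AE_I2) (auto intro: order_trans[OF _ abs_ge_self])
  qed measurable
qed

text \<open>Dominated convergence along sequences, with a multiple of \<open>S\<^sup>2\<close> as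
  majorant.\<close>

lemma profile_energy_tendsto:
  assumes f: "f \<in> profile_algebra"
  shows "(profile_energy f \<longlongrightarrow> profile_energy f 0) (at_right 0)"
proof (rule tendsto_at_right_sequentially)
  \<comment> \<open>Any number strictly between 0 and \<open>1 / \<omega>\<close> would serve; it
    makes the majorant uniform along the sequence.\<close>
  let ?\<delta> = "1 / (2 * \<omega>)"
  show "0 < ?\<delta>" using omega_pos by simp
  have \<delta>: "?\<delta> < 1 / \<omega>" using omega_pos by (simp add: field_simps)
  obtain M where M: "\<forall>\<epsilon>\<in>{0..?\<delta>}. \<forall>y. (norm (of_real (S y) * f \<epsilon> y))\<^sup>2 \<le> M * (S y)\<^sup>2"
    using S_times_profile_dominated[OF f \<delta>] by blast
  fix X :: "nat \<Rightarrow> real"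
  assume X: "\<And>n. 0 < X n" "\<And>n. X n < ?\<delta>" "X \<longlonglongrightarrow> 0"
  have XI: "X n \<in> I" for n using X(1,2)[of n] \<delta> by auto
  have meas: "(\<lambda>y. (norm (of_real (S y) * f \<epsilon> y))\<^sup>2) \<in> borel_measurable lborel" if "\<epsilon> \<in> I" for \<epsilon>
    by (rule borel_measurable_integrable[OF integrable_S_times_profile[OF f that]])
  show "(\<lambda>n. profile_energy f (X n)) \<longlonglongrightarrow> profile_energy f 0"
    unfolding profile_energy_def
  proof (rule integral_dominated_convergence[where w = "\<lambda>y. M * (S y)\<^sup>2"])
    show "integrable lborel (\<lambda>y. M * (S y)\<^sup>2)" by (intro integrable_mult_right integrable_S_square)
    have "(\<lambda>n. f (X n) y) \<longlonglongrightarrow> f 0 y" for y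
      using profile_algebra_continuous[OF f, of y] X(3) XI omega_pos
      by (auto simp: continuous_on_sequentially o_def)
    then show "AE y in lborel. (\<lambda>n. (norm (of_real (S y) * f (X n) y))\<^sup>2) \<longlonglongrightarrow> (norm (of_real (S y) * f 0 y))\<^sup>2"
      by (intro AE_I2 tendsto_intros)
    show "AE y in lborel. norm ((norm (of_real (S y) * f (X n) y))\<^sup>2) \<le> M * (S y)\<^sup>2" for n
      using M X(1,2)[of n] by (auto intro!: AE_I2)
  qed (use meas XI omega_pos in auto)
qed

text \<open>Since the derivative of \<open>S\<close> is \<open>- (a / 2) * S * T\<close>, the
  derivative of \<open>S * g\<close> is \<open>S * (g' - (a / 2) * T * g)\<close>: the factor
  \<open>S\<close> survives and the other factor stays in the algebra. Dependent choice iterates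
  this.\<close>

lemma profile_algebra_derivative_sequence:
  assumes "f \<in> profile_algebra"
  obtains H where "H 0 = f" "\<And>j. H j \<in> profile_algebra"
    "\<And>j. \<forall>\<epsilon>\<in>I. \<forall>y. ((\<lambda>y. of_real (S y) * H j \<epsilon> y) has_vector_derivative of_real (S y) * H (Suc j) \<epsilon> y) (at y)"
proof -
  define R where "R g h \<longleftrightarrow> (\<forall>\<epsilon>\<in>I. \<forall>y. ((\<lambda>y. of_real (S y) * g \<epsilon> y) has_vector_derivative of_real (S y) * h \<epsilon> y) (at y))"
    for g h :: "real \<Rightarrow> real \<Rightarrow> complex"
  have step: "\<exists>h\<in>profile_algebra. R g h" if g: "g \<in> profile_algebra" for g
  proof -
    obtain g' where g': "g' \<in> profile_algebra" "\<forall>\<epsilon>\<in>I. \<forall>y. (g \<epsilon> has_vector_derivative g' \<epsilon> y) (at y)"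
      using profile_algebra_derivative[OF g] by blast
    let ?h = "\<lambda>\<epsilon> y. g' \<epsilon> y + of_real (- (a / 2)) * complex_of_real (T y) * g \<epsilon> y"
    have "?h \<in> profile_algebra"
      by (intro profile_algebra.add profile_algebra.mult profile_algebra.T
          profile_algebra.coefficient continuous_on_const g g'(1))
    moreover have "R g ?h"
      unfolding R_def
    proof (intro ballI allI)
      fix \<epsilon> y assume "\<epsilon> \<in> I"
      with g'(2) has_vector_derivative_mult[OF has_vector_derivative_of_real[OF S_has_derivative, of y], of "g \<epsilon>" "g' \<epsilon> y"]
      show "((\<lambda>y. of_real (S y) * g \<epsilon> y) has_vector_derivative of_real (S y) * ?h \<epsilon> y) (at y)"
        by (simp add: algebra_simps)
    qed
    ultimately show ?thesis by blast
  qed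
  have "\<exists>H. \<forall>n. (H n \<in> profile_algebra \<and> (n = 0 \<longrightarrow> H n = f)) \<and> R (H n) (H (Suc n))"
    by (rule dependent_nat_choice) (use assms step in auto)
  then obtain H where "\<forall>n. (H n \<in> profile_algebra \<and> (n = 0 \<longrightarrow> H n = f)) \<and> R (H n) (H (Suc n))" ..
  then show ?thesis by (intro that[of H]) (auto simp: R_def)
qed

section \<open>The rescaled difference and its limit\<close>

text \<open>The bracket is \<open>A + \<i> * \<epsilon> * \<beta> * T - (2 * r + (1 + \<omega> *
  \<epsilon> - r) * S\<^sup>2)\<close> divided by \<open>\<epsilon>\<close>, after inserting
  \<open>A = 2 + \<epsilon> * \<alpha>\<close> and \<open>r = 1 + \<epsilon> * \<gamma>\<close>; the
  terms of order 0 cancel.\<close>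

definition difference_profile :: "real \<Rightarrow> real \<Rightarrow> complex" where
  "difference_profile \<epsilon> y = of_real a * exp (\<i> * of_real (c * y / 2)) * of_real (E \<epsilon> y)
     * (of_real (\<alpha> \<epsilon> - 2 * \<gamma> \<epsilon>) + \<i> * of_real (\<beta> \<epsilon>) * of_real (T y)
        + of_real (\<gamma> \<epsilon> - \<omega>) * (of_real (S y) * of_real (S y)))"

lemma difference_profile_in_algebra: "difference_profile \<in> profile_algebra"
  unfolding difference_profile_def[abs_def]
  by (intro profile_algebra.add profile_algebra.mult profile_algebra.S profile_algebra.T
      profile_algebra.E profile_algebra.carrier profile_algebra_real_coefficient
      profile_algebra.coefficient continuous_intros continuous_coefficients)

lemma difference_eq:
  assumes "0 < \<epsilon>" "\<epsilon> < 1 / \<omega>"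
  shows "rescaled_LL_soliton c \<omega> \<epsilon> x t - bright_soliton c \<omega> x t
    = exp (\<i> * of_real (\<omega> * t)) * of_real \<epsilon> * (of_real (S (x - c * t)) * difference_profile \<epsilon> (x - c * t))"
proof -
  have \<epsilon>: "\<epsilon> \<in> I" using assms by simp
  define y where "y = x - c * t"
  define C where "C = cosh (a / 2 * y)"
  have C: "C > 0" by (simp add: C_def cosh_real_pos)
  have SC: "S y = 1 / C" by (simp add: S_def C_def)
  have sqrt_a: "sqrt (\<omega> - c\<^sup>2 / 4) = a / 2"
    using a_pos a_square by (intro real_sqrt_unique) (auto simp: power_divide)
  have cosh_ay: "cosh (a * y) = 2 * C\<^sup>2 - 1"
    using cosh_double_cosh[of "a / 2 * y"] by (simp add: C_def)
  have sinh_y: "sinh (a / 2 * y) = C * T y"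
    using C by (simp add: T_def tanh_def C_def)
  have den: "2 * r \<epsilon> + (1 + \<omega> * \<epsilon> - r \<epsilon>) * (S y)\<^sup>2 > 0"
    using denominator_ge[OF \<epsilon>, of y] r_pos[OF \<epsilon>] by simp
  \<comment> \<open>The factor \<open>C\<^sup>2\<close> is pulled out of the denominator. One of the
    two resulting factors \<open>S\<close> then cancels the \<open>C\<close> in the
    numerator.\<close>
  have E1: "1 / (1 + \<omega> * \<epsilon> + r \<epsilon> * (2 * C\<^sup>2 - 1)) = E \<epsilon> y * (S y)\<^sup>2"
    using C by (simp add: E_def SC field_simps)
  \<comment> \<open>Brings the bright soliton over the denominator of the Landau-Lifshitz profile, so that
    the difference has an explicit factor \<open>\<epsilon>\<close>.\<close>
  have E2: "1 = E \<epsilon> y * (2 * r \<epsilon> + (1 + \<omega> * \<epsilon> - r \<epsilon>) * (S y)\<^sup>2)"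
    using den by (simp add: E_def)
  have "rescaled_LL_soliton c \<omega> \<epsilon> x t
      = exp (\<i> * of_real (\<omega> * t)) * (of_real a * exp (\<i> * of_real (c * y / 2))
        * of_real (1 / (1 + \<omega> * \<epsilon> + r \<epsilon> * (2 * C\<^sup>2 - 1)))
        * (of_real (A \<epsilon> * C) + \<i> * of_real (\<epsilon> * \<beta> \<epsilon> * (C * T y))))"
    using assms(1)
    unfolding rescaled_LL_soliton_def LL_profile_def Let_def
    unfolding y_def[symmetric] s_def[symmetric] r_def[symmetric] A_def[symmetric] a_def[symmetric]
      sqrt_a cosh_ay sinh_y sinh_coefficient_eq[OF \<epsilon>] C_def[symmetric]
    by simp
  also have "\<dots> = exp (\<i> * of_real (\<omega> * t)) * (of_real a * exp (\<i> * of_real (c * y / 2))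
        * of_real (S y) * of_real (E \<epsilon> y) * (of_real (A \<epsilon>) + \<i> * of_real (\<epsilon> * \<beta> \<epsilon> * T y)))"
    unfolding E1 using C by (simp add: SC power2_eq_square field_simps)
  finally have LL: "rescaled_LL_soliton c \<omega> \<epsilon> x t = \<dots>" .
  have "bright_soliton c \<omega> x t
      = exp (\<i> * of_real (\<omega> * t)) * (of_real a * exp (\<i> * of_real (c * y / 2)) * of_real (S y) * of_real 1)"
    unfolding bright_soliton_def y_def[symmetric] a_def[symmetric] by (simp add: S_def)
  also have "\<dots> = exp (\<i> * of_real (\<omega> * t)) * (of_real a * exp (\<i> * of_real (c * y / 2)) * of_real (S y)
      * of_real (E \<epsilon> y * (2 * r \<epsilon> + (1 + \<omega> * \<epsilon> - r \<epsilon>) * (S y)\<^sup>2)))"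
    by (simp only: E2[symmetric])
  finally show ?thesis
    unfolding LL y_def[symmetric] difference_profile_def A_eq[OF \<epsilon>] r_eq[OF \<epsilon>]
    by (simp add: algebra_simps power2_eq_square)
qed

text \<open>The contributions of \<open>s\<close> to the bracket cancel, as
  \<open>s / 2 - s + s / 2 = 0\<close>, and only \<open>- \<omega>\<close> is left.\<close>

lemma difference_profile_0_nonzero: "difference_profile 0 0 \<noteq> 0"
proof -
  have 1: "r 0 = 1" "A 0 = 2" "S 0 = 1" "T 0 = 0" by (simp_all add: r_def A_def S_def T_def)
  then have 2: "\<gamma> 0 = s / 2" "\<alpha> 0 = s / 2" "E 0 0 = 1 / 2"
    by (simp_all add: \<gamma>_def \<alpha>_def E_def)
  have "difference_profile 0 0 = of_real (- (a * \<omega> / 2))"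
    unfolding difference_profile_def 1 2 by (simp add: field_simps)
  then show ?thesis using a_pos omega_pos by simp
qed

text \<open>With zero energy, the open set where the continuous integrand does not vanish would be
  null, hence empty, contradicting the value at \<open>y = 0\<close>.\<close>

lemma profile_energy_difference_pos: "profile_energy difference_profile 0 > 0"
proof (rule ccontr)
  let ?f = "\<lambda>y. complex_of_real (S y) * difference_profile 0 y"
  have 0: "0 \<in> I" using omega_pos by simp
  note int = integrable_S_times_profile[OF difference_profile_in_algebra 0]
  assume "\<not> ?thesis"
  moreover have "profile_energy difference_profile 0 \<ge> 0"
    unfolding profile_energy_def by simp
  ultimately have "profile_energy difference_profile 0 = 0" by simp
  then have "AE y in lborel. (norm (?f y))\<^sup>2 = 0"
    unfolding profile_energy_def using integral_nonneg_eq_0_iff_AE[OF int] by simp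
  then have "AE y in lborel. y \<notin> {y. ?f y \<noteq> 0}" by eventually_elim simp
  moreover have op: "open {y. ?f y \<noteq> 0}"
    by (intro open_Collect_neq continuous_S_times_profile[OF difference_profile_in_algebra 0] continuous_on_const)
  ultimately have "{y. ?f y \<noteq> 0} \<in> null_sets lborel"
    by (subst AE_iff_null_sets) auto
  then have "negligible {y. ?f y \<noteq> 0}"
    by (simp add: negligible_iff_null_sets null_sets_completionI)
  then have "{y. ?f y \<noteq> 0} = {}" using open_not_negligible[OF op] by blast
  then have "?f 0 = 0" by blast
  then show False using difference_profile_0_nonzero S_pos[of 0] by simp
qed

section \<open>Sobolev norm of the difference\<close>

text \<open>At fixed \<open>t\<close> the difference is a translate of \<open>S * H 0\<close> times
  a constant of modulus \<open>\<epsilon>\<close>, so its classical derivatives are the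
  \<open>g j\<close>. The right-hand side of the last claim is free of \<open>t\<close>, which makes
  the final constant independent of time.\<close>

lemma difference_weak_derivative:
  fixes H :: "nat \<Rightarrow> real \<Rightarrow> real \<Rightarrow> complex" and \<epsilon> t :: real
  assumes H: "H 0 = difference_profile" "\<And>j. H j \<in> profile_algebra"
    "\<And>j. \<forall>\<epsilon>\<in>I. \<forall>y. ((\<lambda>y. of_real (S y) * H j \<epsilon> y) has_vector_derivative of_real (S y) * H (Suc j) \<epsilon> y) (at y)"
    and \<epsilon>: "0 < \<epsilon>" "\<epsilon> < 1 / \<omega>"
  defines "g j x \<equiv> exp (\<i> * of_real (\<omega> * t)) * of_real \<epsilon> * (of_real (S (x - c * t)) * H j \<epsilon> (x - c * t))"
  shows "has_weak_deriv j (\<lambda>x. rescaled_LL_soliton c \<omega> \<epsilon> x t - bright_soliton c \<omega> x t) (g j)"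
    and "square_integrable (g j)"
    and "(LINT x|lborel. (norm (g j x))\<^sup>2) = \<epsilon>\<^sup>2 * profile_energy (H j) \<epsilon>"
proof -
  have \<epsilon>I: "\<epsilon> \<in> I" using \<epsilon> by simp
  \<comment> \<open>The shift is written as \<open>- (c * t) + 1 * x\<close> to match the affine
    change of variables.\<close>
  have norm_g: "(norm (g j x))\<^sup>2 = \<epsilon>\<^sup>2 * (norm (of_real (S (- (c * t) + 1 * x)) * H j \<epsilon> (- (c * t) + 1 * x)))\<^sup>2" for x
    by (simp add: g_def norm_mult power_mult_distrib)
  have deriv: "(g j has_vector_derivative g (Suc j) x) (at x)" for j x
  proof -
    have "((\<lambda>x. x - c * t) has_vector_derivative 1) (at x)"
      by (auto intro!: derivative_eq_intros)
    from vector_diff_chain_at[OF this H(3)[rule_format, OF \<epsilon>I]]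
    have "((\<lambda>x. of_real (S (x - c * t)) * H j \<epsilon> (x - c * t)) has_vector_derivative
        of_real (S (x - c * t)) * H (Suc j) \<epsilon> (x - c * t)) (at x)"
      by (simp add: o_def)
    then show ?thesis unfolding g_def by (rule has_vector_derivative_mult_right)
  qed
  have "g 0 = (\<lambda>x. rescaled_LL_soliton c \<omega> \<epsilon> x t - bright_soliton c \<omega> x t)"
    by (rule ext) (simp add: g_def difference_eq[OF \<epsilon>] H(1))
  with has_weak_deriv_classical[of g, OF deriv]
  show "has_weak_deriv j (\<lambda>x. rescaled_LL_soliton c \<omega> \<epsilon> x t - bright_soliton c \<omega> x t) (g j)"
    by simp
  have "continuous_on UNIV (g j)"
    using deriv by (auto intro!: continuous_at_imp_continuous_on has_vector_derivative_continuous)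
  then have "g j \<in> borel_measurable lborel"
    using borel_measurable_continuous_onI by simp
  moreover have "integrable lborel (\<lambda>x. (norm (g j x))\<^sup>2)"
    unfolding norm_g
    by (intro integrable_mult_right lborel_integrable_real_affine[OF integrable_S_times_profile[OF H(2) \<epsilon>I]]) simp
  ultimately show "square_integrable (g j)" by (simp add: square_integrable_def)
  show "(LINT x|lborel. (norm (g j x))\<^sup>2) = \<epsilon>\<^sup>2 * profile_energy (H j) \<epsilon>"
    unfolding norm_g profile_energy_def
    using lborel_integral_real_affine[of 1 "\<lambda>y. (norm (of_real (S y) * H j \<epsilon> y))\<^sup>2" "- (c * t)"]
    by simp
qed

end

theorem propositionA3:
  fixes k :: nat and c \<omega> :: real
  assumes "c \<ge> 0" and "\<omega> > 0" and "4 * \<omega> > c\<^sup>2"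
  shows "\<exists>C>0. \<forall>t.
    (\<forall>\<epsilon>. 0 < \<epsilon> \<and> \<epsilon> < 1 / \<omega> \<longrightarrow>
       (\<lambda>x. rescaled_LL_soliton c \<omega> \<epsilon> x t - bright_soliton c \<omega> x t) \<in> sobolev_space k) \<and>
    (\<lambda>\<epsilon>. sobolev_norm k (\<lambda>x. rescaled_LL_soliton c \<omega> \<epsilon> x t - bright_soliton c \<omega> x t))
      \<sim>[at_right 0] (\<lambda>\<epsilon>. C * \<epsilon>)"
proof -
  interpret soliton_parameters c \<omega> using assms by unfold_locales
  obtain H where H: "H 0 = difference_profile" "\<And>j. H j \<in> profile_algebra"
    "\<And>j. \<forall>\<epsilon>\<in>I. \<forall>y. ((\<lambda>y. of_real (S y) * H j \<epsilon> y) has_vector_derivative of_real (S y) * H (Suc j) \<epsilon> y) (at y)"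
    using profile_algebra_derivative_sequence[OF difference_profile_in_algebra] by blast
  note weak = difference_weak_derivative[OF H]
  define C where "C = sqrt (\<Sum>j\<le>k. profile_energy (H j) 0)"
  \<comment> \<open>All terms are nonnegative, and the term \<open>j = 0\<close>, present for every
    \<open>k\<close>, is positive.\<close>
  have "(\<Sum>j\<le>k. profile_energy (H j) 0) > 0"
    using profile_energy_difference_pos
    by (intro sum_pos2[of _ 0]) (auto simp: H(1) profile_energy_def)
  then have "C > 0" by (simp add: C_def)
  moreover have "(\<lambda>x. rescaled_LL_soliton c \<omega> \<epsilon> x t - bright_soliton c \<omega> x t) \<in> sobolev_space k"
    if "0 < \<epsilon>" "\<epsilon> < 1 / \<omega>" for \<epsilon> t
    unfolding sobolev_space_def using weak(1,2)[OF that] by blast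
  moreover have "(\<lambda>\<epsilon>. sobolev_norm k (\<lambda>x. rescaled_LL_soliton c \<omega> \<epsilon> x t - bright_soliton c \<omega> x t))
      \<sim>[at_right 0] (\<lambda>\<epsilon>. C * \<epsilon>)" for t
  proof (rule asymp_equivI')
    \<comment> \<open>This reduces the claim to convergence of the energies, since the factor
      \<open>\<epsilon>\<close> cancels in the quotient.\<close>
    have norm_eq: "sobolev_norm k (\<lambda>x. rescaled_LL_soliton c \<omega> \<epsilon> x t - bright_soliton c \<omega> x t)
        = \<epsilon> * sqrt (\<Sum>j\<le>k. profile_energy (H j) \<epsilon>)" if "0 < \<epsilon>" "\<epsilon> < 1 / \<omega>" for \<epsilon>
      unfolding sobolev_norm_def integral_weak_deriv[OF weak(1)[OF that]] weak(3)[OF that]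
      using that by (simp add: real_sqrt_mult flip: sum_distrib_left)
    have "((\<lambda>\<epsilon>. sqrt (\<Sum>j\<le>k. profile_energy (H j) \<epsilon>) / C) \<longlongrightarrow> C / C) (at_right 0)"
      unfolding C_def using \<open>C > 0\<close>[unfolded C_def]
      by (intro tendsto_intros profile_energy_tendsto H(2)) auto
    then have "((\<lambda>\<epsilon>. sqrt (\<Sum>j\<le>k. profile_energy (H j) \<epsilon>) / C) \<longlongrightarrow> 1) (at_right 0)"
      using \<open>C > 0\<close> by simp
    then show "((\<lambda>\<epsilon>. sobolev_norm k (\<lambda>x. rescaled_LL_soliton c \<omega> \<epsilon> x t - bright_soliton c \<omega> x t)
        / (C * \<epsilon>)) \<longlongrightarrow> 1) (at_right 0)"
    proof (rule Lim_transform_eventually)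
      show "eventually (\<lambda>\<epsilon>. sqrt (\<Sum>j\<le>k. profile_energy (H j) \<epsilon>) / C
          = sobolev_norm k (\<lambda>x. rescaled_LL_soliton c \<omega> \<epsilon> x t - bright_soliton c \<omega> x t) / (C * \<epsilon>)) (at_right 0)"
        by (rule eventually_at_rightI[of 0 "1 / \<omega>"]) (use omega_pos norm_eq in auto)
    qed
  qed
  ultimately show ?thesis by blast
qed

end
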